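(* Let $r,d,n$ be integers with $1\le r<d<n$ and $n\ge 3$. The following conditions are equivalent. (a) $2r\le d$. (b) For any $n$-dimensional real or complex Hilbert space $V$, a $\tau_d$-saturated subset $S\subseteq\mathbb{G}(r,V)$ is of the form $S=\left(\bigcap S\right)^{\uparrow}$, where $\bigcap S$ is the intersection of all the $r$-planes belonging to $S$. Consequently, $\mathbb{G}(\le r,V)\ni\pi\mapsto\pi^{\uparrow}\in 2^{\mathbb{G}(r,V)}$ is a bijection between $\mathbb{G}(\le r,V)$ and the collection of $\tau_d$-saturated sets of $r$-planes. (c) For an $n$-dimensional real or complex Hilbert space $V$, the Grassmannian $\mathbb{G}(r,V)$ contains no 2-element $\tau_d$-saturated subsets.
   Context: For a finite-dimensional real or complex Hilbert space $V$, $\mathbb{G}(r,V)$ denotes the Grassmannian of $r$-dimensional (linear) subspaces of $V$ ("$r$-planes"), and $2^{\mathbb{G}(r,V)}$ is its powerset. For a subspace $\pi\le V$, $P_\pi$ is the orthogonal projection of $V$ onto $\pi$. For $1\le d\le \dim V$ define a ternary relation $\tau_d$ on $\mathbb{G}(r,V)$ by: $\tau_d(\zeta,\zeta'\mid\zeta'')$ holds if and only if there is a $d$-dimensional subspace $\pi\le V$ with $\pi\supseteq\zeta$ and $\zeta''=P_\pi\zeta'$. A subset $S\subseteq\mathbb{G}(r,V)$ is $\tau_d$-saturated if for all $\zeta,\zeta'\in S$ and all $\zeta''\in\mathbb{G}(r,V)$, $\tau_d(\zeta,\zeta'\mid\zeta'')$ implies $\zeta''\in S$. Write $\mathbb{G}(\le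 r,V):=\bigsqcup_{1\le r'\le r}\mathbb{G}(r',V)$. For a subspace $\pi\le V$ put $\pi^{\uparrow}:=\{\pi'\in\mathbb{G}(r,V) : \pi'\supseteq\pi\}$ (the $r$-spine of $\pi$).
   Formalization: The bijection in (b) fails as printed: the empty set and all of G(r,V) are saturated but are not spines of any π of dimension 1..r. It is stated onto the saturated sets other than these two, and also from G(≤r,V) with {0} and V adjoined onto all saturated sets. *)

theory Defs
  imports "HOL-Analysis.Analysis"
begin

text \<open>
  Finite-dimensional inner product spaces on a whole type \<open>'v\<close>, uniformly over the real and the
  complex scalars: \<open>cj\<close> is the conjugation of the scalar field, that is the identity on the reals and
  \<^const>\<open>cnj\<close> on the complex numbers.  The inner product is linear in its first argument.
  Completeness is not assumed because it is automatic in finite dimension.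
\<close>

locale fd_inner_product_space = vector_space smul
  for smul :: "'k::real_normed_field \<Rightarrow> 'v::ab_group_add \<Rightarrow> 'v" +
  fixes cj :: "'k \<Rightarrow> 'k"
    and ip :: "'v \<Rightarrow> 'v \<Rightarrow> 'k"
  assumes ip_add_left: "ip (x + y) z = ip x z + ip y z"
    and ip_scale_left: "ip (smul c x) y = c * ip x y"
    and ip_commute: "ip y x = cj (ip x y)"
    and ip_pos: "x \<noteq> 0 \<Longrightarrow> \<exists>t>0. ip x x = of_real t"
    and finite_dim: "\<exists>B. finite B \<and> span B = UNIV"

definition real_hilbert_space ::
    "nat \<Rightarrow> (real \<Rightarrow> 'v::ab_group_add \<Rightarrow> 'v) \<Rightarrow> ('v \<Rightarrow> 'v \<Rightarrow> real) \<Rightarrow> bool" where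
  "real_hilbert_space n smul ip \<longleftrightarrow>
     fd_inner_product_space smul (\<lambda>c. c) ip \<and> vector_space.dim smul (UNIV :: 'v set) = n"

definition complex_hilbert_space ::
    "nat \<Rightarrow> (complex \<Rightarrow> 'v::ab_group_add \<Rightarrow> 'v) \<Rightarrow> ('v \<Rightarrow> 'v \<Rightarrow> complex) \<Rightarrow> bool" where
  "complex_hilbert_space n smul ip \<longleftrightarrow>
     fd_inner_product_space smul cnj ip \<and> vector_space.dim smul (UNIV :: 'v set) = n"

definition grassmannian ::
    "('k::field \<Rightarrow> 'v::ab_group_add \<Rightarrow> 'v) \<Rightarrow> nat \<Rightarrow> 'v set set" where
  "grassmannian smul r = {U. module.subspace smul U \<and> vector_space.dim smul U = r}"

definition grassmannian_le ::
    "('k::field \<Rightarrow> 'v::ab_group_add \<Rightarrow> 'v) \<Rightarrow> nat \<Rightarrow> 'v set set" where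
  "grassmannian_le smul r = (\<Union>r'\<in>{1..r}. grassmannian smul r')"

definition orth_proj ::
    "('v::ab_group_add \<Rightarrow> 'v \<Rightarrow> 'k::field) \<Rightarrow> 'v set \<Rightarrow> 'v \<Rightarrow> 'v" where
  "orth_proj ip U x = (THE y. y \<in> U \<and> (\<forall>u\<in>U. ip (x - y) u = 0))"

definition tau ::
    "('k::field \<Rightarrow> 'v::ab_group_add \<Rightarrow> 'v) \<Rightarrow> ('v \<Rightarrow> 'v \<Rightarrow> 'k) \<Rightarrow> nat \<Rightarrow>
      'v set \<Rightarrow> 'v set \<Rightarrow> 'v set \<Rightarrow> bool" where
  "tau smul ip d \<zeta> \<zeta>' \<zeta>'' \<longleftrightarrow>
     (\<exists>\<pi>\<in>grassmannian smul d. \<zeta> \<subseteq> \<pi> \<and> \<zeta>'' = orth_proj ip \<pi> ` \<zeta>')"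

definition tau_saturated ::
    "('k::field \<Rightarrow> 'v::ab_group_add \<Rightarrow> 'v) \<Rightarrow> ('v \<Rightarrow> 'v \<Rightarrow> 'k) \<Rightarrow> nat \<Rightarrow> nat \<Rightarrow>
      'v set set \<Rightarrow> bool" where
  "tau_saturated smul ip r d S \<longleftrightarrow>
     S \<subseteq> grassmannian smul r \<and>
     (\<forall>\<zeta>\<in>S. \<forall>\<zeta>'\<in>S. \<forall>\<zeta>''\<in>grassmannian smul r. tau smul ip d \<zeta> \<zeta>' \<zeta>'' \<longrightarrow> \<zeta>'' \<in> S)"

definition spine ::
    "('k::field \<Rightarrow> 'v::ab_group_add \<Rightarrow> 'v) \<Rightarrow> nat \<Rightarrow> 'v set \<Rightarrow> 'v set set" where
  "spine smul r \<pi> = {\<pi>'\<in>grassmannian smul r. \<pi> \<subseteq> \<pi>'}"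

text \<open>
  The empty set and the full Grassmannian are always saturated, but they are the spines of the whole
  space and of the zero subspace, neither of which has dimension in \<open>{1..r}\<close>.  Hence the bijection is
  stated twice: from \<^const>\<open>grassmannian_le\<close> onto the saturated sets other than these two, and, after
  adjoining the two extreme subspaces to the domain, onto all saturated sets.  In the first conjunct
  the intersection of the empty family is the whole space, so that \<open>S = {}\<close> needs no exception.
\<close>

definition saturated_sets_are_spines ::
    "('k::field \<Rightarrow> 'v::ab_group_add \<Rightarrow> 'v) \<Rightarrow> ('v \<Rightarrow> 'v \<Rightarrow> 'k) \<Rightarrow> nat \<Rightarrow> nat \<Rightarrow> bool" where
  "saturated_sets_are_spines smul ip r d \<longleftrightarrow>
     (\<forall>S. tau_saturated smul ip r d S \<longrightarrow> S = spine smul r (\<Inter>S)) \<and>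
     bij_betw (spine smul r) (grassmannian_le smul r)
       ({S. tau_saturated smul ip r d S} - {{}, grassmannian smul r}) \<and>
     bij_betw (spine smul r) ({{0}, UNIV} \<union> grassmannian_le smul r)
       {S. tau_saturated smul ip r d S}"

definition no_two_element_saturated_set ::
    "('k::field \<Rightarrow> 'v::ab_group_add \<Rightarrow> 'v) \<Rightarrow> ('v \<Rightarrow> 'v \<Rightarrow> 'k) \<Rightarrow> nat \<Rightarrow> nat \<Rightarrow> bool" where
  "no_two_element_saturated_set smul ip r d \<longleftrightarrow>
     \<not> (\<exists>S. tau_saturated smul ip r d S \<and> card S = 2)"

end

theory Submission
  imports Defs
begin

text \<open>
  Let \<open>2 r \<le> d\<close> and let \<open>S\<close> be saturated.  Suppose that \<open>Z, T \<in> S\<close> and that \<open>H\<close> is a hyperplane of \<open>Z\<close>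
  containing \<open>Z \<inter> T\<close>.  Projecting \<open>Z\<close> to suitable spaces containing \<open>T + H\<close> produces a second member of \<open>S\<close>
  through \<open>H\<close>.  Members of \<open>S\<close> through \<open>H\<close> are lines in the orthogonal complement of \<open>H\<close>, whose dimension is at
  least 3, and two distinct lines generate all of them: the moves strictly increase angles until two of
  the lines are orthogonal, and an orthogonal pair generates everything.  So \<open>S\<close> contains the spine of
  \<open>H\<close>, and replacing hyperplanes one at a time shows that it contains the spine of \<open>Z \<inter> T\<close>.  When
  \<open>dim (Z \<inter> T)\<close> is minimal, \<open>Z \<inter> T\<close> lies in every member of \<open>S\<close>, as otherwise a member in general
  position over \<open>Z \<inter> T\<close> would give a smaller intersection.

  If \<open>d < 2 r\<close>, put \<open>Z = W + A\<close> and \<open>T = W + B\<close> with \<open>W, A, B\<close> pairwise orthogonal and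
  \<open>dim A = dim B = d - r + 1\<close>.  A \<open>d\<close>-dimensional space containing one of \<open>Z, T\<close> has too little room left to
  project the other one injectively, so \<open>{Z, T}\<close> is saturated.
\<close>

section \<open>Orthogonal projections and intermediate subspaces\<close>

text \<open>
  \<^locale>\<open>fd_inner_product_space\<close> does not force \<open>cj\<close> to be additive: on a one-dimensional space
  \<open>ip x y = x / y\<close> with \<open>cj c = 1 / c\<close> satisfies its axioms.
\<close>

locale conj_inner_product_space = fd_inner_product_space smul cj ip
  for smul :: "'k::real_normed_field \<Rightarrow> 'v::ab_group_add \<Rightarrow> 'v" and cj :: "'k \<Rightarrow> 'k"
    and ip :: "'v \<Rightarrow> 'v \<Rightarrow> 'k" +
  assumes cj_add: "cj (a + b) = cj a + cj b"
    and cj_mult: "cj (a * b) = cj a * cj b"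
    and cj_of_real: "cj (of_real t) = of_real t"
begin

text \<open>The library's finite-dimensional locale takes a basis as a parameter, while here only a
  finite spanning set is assumed; any chosen basis serves.\<close>

definition fin_basis :: "'v set" where
  "fin_basis = (SOME B. finite B \<and> independent B \<and> span B = UNIV)"

lemma fin_basis: "finite fin_basis" "independent fin_basis" "span fin_basis = UNIV"
proof -
  obtain A where A: "finite A" "span A = UNIV"
    using finite_dim by blast
  obtain B where B: "B \<subseteq> A" "independent B" "A \<subseteq> span B"
    by (rule maximal_independent_subset[of A])
  have "finite B"
    using A B finite_subset by blast
  moreover have "span B = UNIV"
    using A B by (metis span_mono span_span top.extremum_uniqueI)
  ultimately have "\<exists>B. finite B \<and> independent B \<and> span B = UNIV"
    using B by blast
  from someI_ex[OF this] show "finite fin_basis" "independent fin_basis" "span fin_basis = UNIV"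
    by (auto simp: fin_basis_def)
qed

sublocale finite_dimensional_vector_space smul fin_basis
  by unfold_locales (auto simp: fin_basis)

declare dim_UNIV [simp del]

lemma cj_zero [simp]: "cj 0 = 0"
  using cj_of_real[of 0] by simp

lemma ip_add_right: "ip z (x + y) = ip z x + ip z y"
  by (metis ip_add_left ip_commute cj_add)

lemma ip_scale_right: "ip x (smul c y) = cj c * ip x y"
  by (metis ip_scale_left ip_commute cj_mult)

lemma ip_zero_left [simp]: "ip 0 x = 0"
  using ip_add_left[of 0 0 x] by simp

lemma ip_zero_right [simp]: "ip x 0 = 0"
  using ip_add_right[of x 0 0] by simp

lemma ip_minus_left: "ip (- x) y = - ip x y"
  using ip_add_left[of x "- x" y] by (simp add: eq_neg_iff_add_eq_0 add.commute)

lemma ip_minus_right: "ip x (- y) = - ip x y"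
  using ip_add_right[of x y "- y"] by (simp add: eq_neg_iff_add_eq_0 add.commute)

lemma ip_diff_left: "ip (x - y) z = ip x z - ip y z"
  using ip_add_left[of x "- y" z] by (simp add: ip_minus_left)

lemma ip_diff_right: "ip z (x - y) = ip z x - ip z y"
  using ip_add_right[of z x "- y"] by (simp add: ip_minus_right)

lemmas ip_simps = ip_add_left ip_add_right ip_diff_left ip_diff_right ip_scale_left ip_scale_right

lemma ip_sym0: "ip x y = 0 \<longleftrightarrow> ip y x = 0"
  by (metis ip_commute cj_zero)

lemma ip_self_eq_0 [simp]: "ip x x = 0 \<longleftrightarrow> x = 0"
  using ip_pos[of x] by (cases "x = 0") auto

lemma ip_span_right:
  assumes "\<And>u. u \<in> A \<Longrightarrow> ip x u = 0" "v \<in> span A"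
  shows "ip x v = 0"
proof -
  have "subspace {v. ip x v = 0}"
    by (auto simp: subspace_def ip_simps)
  then have "span A \<subseteq> {v. ip x v = 0}"
    using assms(1) by (intro span_minimal) auto
  then show ?thesis
    using assms(2) by blast
qed

lemma subspace_orth_left: "subspace {x. ip x w = 0}"
  by (auto simp: subspace_def ip_simps)

lemma subspace_orth_right: "subspace {x. ip w x = 0}"
  by (auto simp: subspace_def ip_simps)

text \<open>A Gram-Schmidt step: the part \<open>b1\<close> of the new vector orthogonal to
  \<open>span B\<close> supplies the correction to the projection \<open>y\<close> already
  found.\<close>

lemma projection_exists_span:
  assumes "finite B"
  shows "\<exists>y\<in>span B. \<forall>u\<in>span B. ip (x - y) u = 0"
  using assms
proof (induction B arbitrary: x rule: finite_induct)
  case empty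
  then show ?case by simp
next
  case (insert b B)
  obtain b0 where b0: "b0 \<in> span B" "\<And>u. u \<in> span B \<Longrightarrow> ip (b - b0) u = 0"
    using insert.IH by metis
  obtain y where y: "y \<in> span B" "\<And>u. u \<in> span B \<Longrightarrow> ip (x - y) u = 0"
    using insert.IH by metis
  define b1 where "b1 = b - b0"
  \<comment> \<open>When \<open>b\<close> already lies in \<open>span B\<close>, \<open>b1\<close>
    is zero and division by zero gives \<open>s = 0\<close>.\<close>
  define s where "s = ip (x - y) b1 / ip b1 b1"
  define y' where "y' = y + smul s b1"
  have le: "span B \<subseteq> span (insert b B)"
    by (simp add: span_mono subset_insertI)
  have y': "y' \<in> span (insert b B)"
    unfolding y'_def b1_def using y(1) b0(1) le
    by (intro span_add span_scale span_diff) (auto intro: span_base)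
  have orthB: "ip (x - y') u = 0" if "u \<in> span B" for u
    using y(2)[OF that] b0(2)[OF that] by (simp add: y'_def b1_def ip_simps algebra_simps)
  have "ip (x - y') b1 = ip (x - y) b1 - s * ip b1 b1"
    by (simp add: y'_def ip_simps)
  also have "\<dots> = 0"
    by (cases "b1 = 0") (auto simp: s_def)
  finally have "ip (x - y') b = 0"
    using orthB[OF b0(1)] by (simp add: b1_def ip_diff_right)
  then have "ip (x - y') u = 0" if "u \<in> span (insert b B)" for u
    using that orthB by (intro ip_span_right[of "insert b B" "x - y'" u]) (auto intro: span_base)
  then show ?case
    using y' by blast
qed

lemma projection_exists:
  assumes "subspace U"
  obtains y where "y \<in> U" "\<And>u. u \<in> U \<Longrightarrow> ip (x - y) u = 0"
proof -
  obtain B where B: "B \<subseteq> U" "independent B" "U \<subseteq> span B"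
    using basis_exists[of U] by metis
  then have "finite B" "span B = U"
    using assms finiteI_independent span_subspace by auto
  then show ?thesis
    using projection_exists_span[of B x] that by auto
qed

lemma orth_proj_eqI:
  assumes "subspace U" "y \<in> U" "\<And>u. u \<in> U \<Longrightarrow> ip (x - y) u = 0"
  shows "orth_proj ip U x = y"
  unfolding orth_proj_def
proof (rule the_equality)
  show "y \<in> U \<and> (\<forall>u\<in>U. ip (x - y) u = 0)"
    using assms by blast
next
  fix z assume z: "z \<in> U \<and> (\<forall>u\<in>U. ip (x - z) u = 0)"
  have "z - y \<in> U"
    using z assms subspace_diff by blast
  then have "ip ((x - y) - (x - z)) (z - y) = 0"
    using z assms by (simp add: ip_diff_left)
  then show "z = y"
    by simp
qed

lemma orth_proj_props:
  assumes "subspace U"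
  shows "orth_proj ip U x \<in> U" "\<And>u. u \<in> U \<Longrightarrow> ip (x - orth_proj ip U x) u = 0"
proof -
  obtain y where y: "y \<in> U" "\<And>u. u \<in> U \<Longrightarrow> ip (x - y) u = 0"
    using projection_exists[OF assms] by blast
  with orth_proj_eqI[OF assms this] show "orth_proj ip U x \<in> U" "\<And>u. u \<in> U \<Longrightarrow> ip (x - orth_proj ip U x) u = 0"
    by auto
qed

lemma orth_proj_id: "subspace U \<Longrightarrow> x \<in> U \<Longrightarrow> orth_proj ip U x = x"
  by (rule orth_proj_eqI) auto

section \<open>Dimension counts and subspaces in prescribed position\<close>

lemma dim_span_insert:
  assumes "subspace U" "x \<notin> U"
  shows "dim (span (insert x U)) = Suc (dim U)"
  using assms by (simp add: dim_insert span_eq_iff[THEN iffD2])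

lemma dim_span_insert_le: "dim (span (insert x U)) \<le> Suc (dim U)"
  by (simp add: dim_insert)

lemma dim_span_Un_le:
  assumes "subspace U" "subspace W"
  shows "dim (span (U \<union> W)) \<le> dim U + dim W"
proof -
  have "span (U \<union> W) = {x + y |x y. x \<in> U \<and> y \<in> W}"
    using assms by (simp add: span_Un span_eq_iff[THEN iffD2])
  then show ?thesis
    using dim_sums_Int[OF assms] by (simp add: add.commute)
qed

lemma notin_proper_span:
  assumes "dim A < dim (UNIV :: 'v set)"
  obtains x where "x \<notin> span A"
proof -
  have "span A \<noteq> UNIV"
    using assms by (metis dim_span less_irrefl)
  then show ?thesis
    using that by blast
qed

lemma orthogonal_vector_exists:
  assumes "dim A < dim (UNIV :: 'v set)"
  obtains e where "e \<noteq> 0" "\<And>u. u \<in> A \<Longrightarrow> ip e u = 0"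
proof -
  obtain x where x: "x \<notin> span A"
    using assms notin_proper_span by blast
  let ?e = "x - orth_proj ip (span A) x"
  have "?e \<noteq> 0"
    using x orth_proj_props(1)[OF subspace_span, of A x] by auto
  moreover have "ip ?e u = 0" if "u \<in> A" for u
    using that by (intro orth_proj_props) (auto intro: span_base)
  ultimately show ?thesis
    using that by blast
qed

lemma intermediate_subspace:
  assumes "subspace U" "subspace W" "U \<subseteq> W" "dim U \<le> d" "d \<le> dim W"
  obtains V where "subspace V" "U \<subseteq> V" "V \<subseteq> W" "dim V = d"
proof -
  have "\<exists>V. subspace V \<and> U \<subseteq> V \<and> V \<subseteq> W \<and> dim V = d"
    using assms
  proof (induction "d - dim U" arbitrary: U)
    case 0
    then have "dim U = d" by simp
    with 0 show ?case by blast
  next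
    case (Suc m)
    then have "dim U < dim W" by linarith
    then obtain x where x: "x \<in> W" "x \<notin> U"
      using dim_subset leD by blast
    let ?U = "span (insert x U)"
    have d: "dim ?U = Suc (dim U)"
      using dim_span_insert Suc x by blast
    have "?U \<subseteq> W"
      using Suc x by (intro span_minimal) auto
    moreover have "U \<subseteq> ?U"
      using span_superset by blast
    moreover have "m = d - dim ?U" "dim ?U \<le> d"
      using Suc d by auto
    ultimately obtain V where "subspace V" "?U \<subseteq> V" "V \<subseteq> W" "dim V = d"
      using Suc.hyps(1)[of ?U] Suc.prems by auto
    then show ?case
      using \<open>U \<subseteq> ?U\<close> by blast
  qed
  then show ?thesis
    using that by blast
qed

lemma dim_orth_complement_line:
  assumes "subspace W" "p \<in> W" "p \<noteq> 0"
  shows "Suc (dim {x \<in> W. ip x p = 0}) = dim W"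
proof -
  let ?H = "{x \<in> W. ip x p = 0}"
  have sub: "subspace ?H"
    using subspace_inter[OF assms(1) subspace_orth_left[of p]] by (simp add: Collect_conj_eq)
  have "W \<subseteq> span (insert p ?H)"
  proof
    fix x assume x: "x \<in> W"
    let ?k = "ip x p / ip p p"
    have "x - smul ?k p \<in> ?H"
      using assms x by (auto simp: ip_simps intro: subspace_diff subspace_scale)
    then show "x \<in> span (insert p ?H)"
      by (auto simp: span_insert intro: span_base)
  qed
  moreover have "span (insert p ?H) \<subseteq> W"
    using assms by (intro span_minimal) auto
  ultimately have "span (insert p ?H) = W" by blast
  then show ?thesis
    using dim_span_insert[OF sub, of p] assms by simp
qed

text \<open>\<open>H\<close> is the orthogonal complement, inside \<open>W\<close>, of the component
  of \<open>p\<close> orthogonal to \<open>U\<close>.\<close>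

lemma hyperplane_avoiding:
  assumes "subspace U" "subspace W" "U \<subseteq> W" "p \<in> W" "p \<notin> U"
  obtains H where "subspace H" "U \<subseteq> H" "H \<subseteq> W" "p \<notin> H" "Suc (dim H) = dim W"
proof -
  obtain y where y: "y \<in> U" "\<And>u. u \<in> U \<Longrightarrow> ip (p - y) u = 0"
    using projection_exists[OF assms(1)] by blast
  let ?q = "p - y"
  let ?H = "{x \<in> W. ip x ?q = 0}"
  have q: "?q \<in> W" "?q \<noteq> 0"
    using assms y by (auto intro: subspace_diff)
  have "subspace ?H"
    using subspace_inter[OF assms(2) subspace_orth_left[of ?q]] by (simp add: Collect_conj_eq)
  moreover have "U \<subseteq> ?H"
    using assms y by (auto simp: ip_sym0[of _ ?q])
  moreover have "p \<notin> ?H"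
  proof
    assume "p \<in> ?H"
    then have "ip (p - y) ?q = 0"
      using \<open>U \<subseteq> ?H\<close> y by (auto simp: ip_diff_left)
    then show False using q by simp
  qed
  ultimately show ?thesis
    using that[of ?H] dim_orth_complement_line[OF assms(2) q] by blast
qed

lemma orthogonal_generator:
  assumes "subspace H" "subspace W" "H \<subseteq> W" "Suc (dim H) = dim W"
  obtains c where "c \<noteq> 0" "\<And>u. u \<in> H \<Longrightarrow> ip c u = 0" "W = span (insert c H)"
proof -
  obtain x where x: "x \<in> W" "x \<notin> H"
    using assms by (metis lessI dim_subset leD subsetI)
  obtain y where y: "y \<in> H" "\<And>u. u \<in> H \<Longrightarrow> ip (x - y) u = 0"
    using projection_exists[OF assms(1)] by blast
  let ?c = "x - y"
  have c: "?c \<in> W" "?c \<noteq> 0"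
    using assms x y by (auto intro: subspace_diff)
  then have "?c \<notin> H"
    using y(2)[of ?c] by auto
  then have "dim (span (insert ?c H)) = dim W"
    using dim_span_insert assms by metis
  moreover have "span (insert ?c H) \<subseteq> W"
    using assms c by (intro span_minimal) auto
  ultimately have "span (insert ?c H) = W"
    using assms by (intro subspace_dim_equal) auto
  then show ?thesis
    using that c y by blast
qed

text \<open>Vectors outside \<open>span (W \<union> T)\<close> are adjoined to \<open>W\<close> one
  at a time, which never enlarges the intersection with \<open>T\<close>; the dimension bound
  guarantees that such vectors exist. This supplies members in general position.\<close>

lemma avoiding_subspace:
  assumes "subspace W" "subspace T" "dim W \<le> r" "r + dim T \<le> dim (UNIV :: 'v set)"
  obtains Z where "subspace Z" "W \<subseteq> Z" "dim Z = r" "Z \<inter> T = W \<inter> T"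
proof -
  have "\<exists>Z. subspace Z \<and> W \<subseteq> Z \<and> dim Z = r \<and> Z \<inter> T = W \<inter> T"
    using assms(1,3)
  proof (induction "r - dim W" arbitrary: W)
    case 0
    then have "dim W = r" by simp
    with 0 show ?case by blast
  next
    case (Suc m)
    have "dim (W \<union> T) \<le> dim W + dim T"
      using dim_span_Un_le[OF Suc.prems(1) assms(2)] by simp
    then have "dim (W \<union> T) < dim (UNIV :: 'v set)"
      using Suc assms(4) by linarith
    then obtain v where v: "v \<notin> span (W \<union> T)"
      using notin_proper_span by blast
    let ?W = "span (insert v W)"
    have "v \<notin> W"
      using v by (auto intro: span_base)
    then have d: "dim ?W = Suc (dim W)"
      using dim_span_insert Suc by blast
    have "W \<subseteq> ?W"
      using span_superset by blast
    have "?W \<inter> T \<subseteq> W"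
    proof
      fix x assume x: "x \<in> ?W \<inter> T"
      then obtain k where k: "x - smul k v \<in> W"
        using Suc.prems by (auto simp: span_breakdown_eq span_eq_iff[THEN iffD2])
      have "x - (x - smul k v) \<in> span (W \<union> T)"
        using x k by (intro span_diff[OF span_base span_base]) auto
      then have "smul k v \<in> span (W \<union> T)" by simp
      then have "k = 0"
        using v by (metis span_scale scale_scale scale_one left_inverse)
      then show "x \<in> W" using k by simp
    qed
    then have "?W \<inter> T = W \<inter> T"
      using \<open>W \<subseteq> ?W\<close> by blast
    moreover have "m = r - dim ?W" "dim ?W \<le> r"
      using Suc.hyps(2) d by auto
    then obtain Z where "subspace Z" "?W \<subseteq> Z" "dim Z = r" "Z \<inter> T = ?W \<inter> T"
      using Suc.hyps(1)[of ?W] subspace_span by blast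
    ultimately show ?case
      using \<open>W \<subseteq> ?W\<close> by blast
  qed
  then show ?thesis
    using that by blast
qed

end

section \<open>Families of lines closed under projection\<close>

text \<open>Models the members of \<open>S\<close> through a fixed hyperplane \<open>H\<close>:
  \<open>X\<close> is to be the orthogonal complement of \<open>H\<close>, and \<open>L x\<close>
  says that \<open>x\<close> and \<open>H\<close> span a member. In \<open>L_move\<close>, the line
  of \<open>a\<close> is projected onto the line of \<open>c\<close> by a space containing
  \<open>b\<close>. The assumption \<open>perp_exists\<close> holds as soon as \<open>X\<close> has
  dimension at least 3.\<close>

locale line_family = conj_inner_product_space smul cj ip
  for smul :: "'k::real_normed_field \<Rightarrow> 'v::ab_group_add \<Rightarrow> 'v" and cj :: "'k \<Rightarrow> 'k"
    and ip :: "'v \<Rightarrow> 'v \<Rightarrow> 'k" +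
  fixes X :: "'v set" and L :: "'v \<Rightarrow> bool"
  assumes X: "subspace X"
    and L_imp: "L x \<Longrightarrow> x \<in> X \<and> x \<noteq> 0"
    and L_scale: "L x \<Longrightarrow> k \<noteq> 0 \<Longrightarrow> L (smul k x)"
    and L_move: "L a \<Longrightarrow> L b \<Longrightarrow> c \<in> X \<Longrightarrow> c \<noteq> 0 \<Longrightarrow> ip (a - c) b = 0 \<Longrightarrow> ip (a - c) c = 0 \<Longrightarrow> L c"
    and perp_exists: "\<exists>f\<in>X. f \<noteq> 0 \<and> ip f b = 0 \<and> ip f c = 0"
begin

text \<open>The projection \<open>k c\<close> of \<open>a\<close> to the line of \<open>c\<close> is
  a legitimate move, as \<open>a - k c\<close> inherits orthogonality to \<open>b\<close>.\<close>

lemma L_orth_if_nonorth: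
  assumes "L a" "L b" "c \<in> X" "ip a b = 0" "ip c b = 0" "ip a c \<noteq> 0"
  shows "L c"
proof -
  define k where "k = ip a c / ip c c"
  have c: "c \<noteq> 0" and k: "k \<noteq> 0"
    using assms by (auto simp: k_def)
  have orth: "ip (a - smul k c) c = 0"
    using c by (simp add: ip_simps k_def)
  have "L (smul k c)"
    by (rule L_move[of a b]) (use assms c k X orth in \<open>auto simp: ip_simps subspace_scale\<close>)
  then show ?thesis
    using L_scale[of "smul k c" "inverse k"] k by simp
qed

text \<open>If \<open>a\<close> and \<open>c\<close> are orthogonal, the detour through
  \<open>a + c\<close>, orthogonal to neither, reaches \<open>c\<close> in two moves.\<close>

lemma L_orth:
  assumes "L a" "L b" "c \<in> X" "c \<noteq> 0" "ip a b = 0" "ip c b = 0"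
  shows "L c"
proof (cases "ip a c = 0")
  case False
  then show ?thesis
    using assms L_orth_if_nonorth by blast
next
  case True
  have "L (a + c)"
    by (rule L_orth_if_nonorth[of a b]) (use assms True X L_imp in \<open>auto simp: ip_simps intro: subspace_add\<close>)
  then show ?thesis
    by (rule L_orth_if_nonorth[of "a + c" b]) (use assms True in \<open>auto simp: ip_simps\<close>)
qed

text \<open>With \<open>f\<close> orthogonal to \<open>b\<close> and \<open>c\<close>, one passes
  from \<open>a\<close> to \<open>f\<close> within the complement of \<open>b\<close>, then from
  \<open>b\<close> to \<open>c\<close> within the complement of \<open>f\<close>.\<close>

lemma L_all_if_orthogonal_pair:
  assumes "L a" "L b" "ip a b = 0" "c \<in> X" "c \<noteq> 0"
  shows "L c"
proof -
  obtain f where f: "f \<in> X" "f \<noteq> 0" "ip f b = 0" "ip f c = 0"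
    using perp_exists by blast
  have "L f"
    using assms f L_orth by blast
  then show ?thesis
    using L_orth[of b f c] assms f by (simp add: ip_sym0)
qed

text \<open>Thales' theorem: these points form the circle with diameter from \<open>b\<close> to
  \<open>b + a\<close> in the directions \<open>a\<close> and \<open>f\<close>, so the vectors from
  such a point to the two ends are orthogonal. As \<open>b + a - c\<close> is also orthogonal to
  \<open>b\<close>, it is orthogonal to \<open>c\<close>.\<close>

lemma L_disc:
  fixes s t :: real
  assumes "L b" "L (b + a)" "f \<in> X" "ip a b = 0" "ip f a = 0" "ip f b = 0" "ip f f = ip a a"
    and st: "s\<^sup>2 = t - t\<^sup>2"
  shows "L (b + smul (of_real t) a + smul (of_real s) f)"
proof (rule L_move[OF assms(2,1)])
  let ?c = "b + smul (of_real t) a + smul (of_real s) f"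
  note 0 = assms(4-6) assms(4-6)[THEN ip_sym0[THEN iffD1]]
  have "a \<in> X"
    using assms(1,2) L_imp X subspace_diff[of X "b + a" b] by simp
  then show "?c \<in> X"
    using assms(1,3) L_imp X by (intro subspace_add subspace_scale) auto
  have "ip ?c b = ip b b"
    using 0 by (simp add: ip_simps)
  then show "?c \<noteq> 0"
    using assms(1) L_imp by auto
  show "ip (b + a - ?c) b = 0"
    using 0 by (simp add: ip_simps)
  have "ip (b + a - ?c) ?c = of_real (t - t\<^sup>2 - s\<^sup>2) * ip a a"
    using 0 assms(7) by (simp add: ip_simps cj_of_real algebra_simps power2_eq_square)
  then show "ip (b + a - ?c) ?c = 0"
    using st by simp
qed

text \<open>\<open>x\<close> is the squared tangent of the angle between the lines spanned by \<open>b\<close> and \<open>b + a\<close>.\<close>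

definition L_tan2 :: "real \<Rightarrow> bool" where
  "L_tan2 x \<longleftrightarrow> (\<exists>b a B. L b \<and> L (b + a) \<and> ip a b = 0 \<and> B > 0 \<and>
     ip b b = of_real B \<and> ip a a = of_real (x * B))"

lemma perp_of_square:
  assumes "y > 0"
  obtains f where "f \<in> X" "ip f b = 0" "ip f c = 0" "ip f f = of_real y"
proof -
  obtain f where f: "f \<in> X" "f \<noteq> 0" "ip f b = 0" "ip f c = 0"
    using perp_exists by blast
  obtain F where F: "F > 0" "ip f f = of_real F"
    using f ip_pos by blast
  define g where "g = smul (of_real (sqrt (y / F))) f"
  have "ip g g = of_real (sqrt (y / F) * sqrt (y / F) * F)"
    by (simp add: g_def ip_simps cj_of_real F mult.assoc del: real_sqrt_mult_self)
  also have "sqrt (y / F) * sqrt (y / F) * F = y"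
    using assms F by simp
  finally have "ip g g = of_real y" .
  moreover have "g \<in> X" "ip g b = 0" "ip g c = 0"
    using f X by (auto simp: g_def ip_simps subspace_scale)
  ultimately show ?thesis
    using that by blast
qed

text \<open>The new pair is \<open>b + a / 2 \<plusminus> f / 2\<close>, with \<open>f\<close> orthogonal to \<open>a\<close> and \<open>b\<close> and as long as \<open>a\<close>.\<close>

lemma L_tan2_step:
  assumes "L_tan2 x" "x > 0"
  shows "L_tan2 (x + x\<^sup>2 / 4)"
proof -
  obtain b a B where *: "L b" "L (b + a)" "ip a b = 0" "B > 0"
    "ip b b = of_real B" "ip a a = of_real (x * B)"
    using assms by (auto simp: L_tan2_def)
  obtain f where f: "f \<in> X" "ip f b = 0" "ip f a = 0" "ip f f = of_real (x * B)"
    using perp_of_square[of "x * B" b a] assms * by auto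
  note 0 = *(3) f(2,3) *(3)[THEN ip_sym0[THEN iffD1]] f(2,3)[THEN ip_sym0[THEN iffD1]]
  define h :: real where "h = 1 / 2"
  have h: "h * h = 1 / 4"
    by (simp add: h_def)
  define p where "p s = b + smul (of_real h) a + smul (of_real s) f" for s
  have L: "L (p s)" if "s\<^sup>2 = h - h\<^sup>2" for s
    unfolding p_def by (rule L_disc) (use * f that in auto)
  have ipc: "ip (p s) (p s') = of_real (B + h * h * x * B + s * s' * x * B)" for s s'
    unfolding p_def using 0 * f by (simp add: ip_simps cj_of_real)
  define b' where "b' = p (- h)"
  define e where "e = p h"
  \<comment> \<open>\<open>k\<close> equals \<open>ip b' b' / ip e b'\<close>, which makes
    \<open>a'\<close> orthogonal to \<open>b'\<close>. The cosine of the new angle is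
    \<open>1 / k\<close>, so its squared tangent is \<open>k^2 - 1 = x + x^2 / 4\<close>.\<close>
  define k where "k = 1 + x / 2"
  define a' where "a' = smul (of_real k) e - b'"
  have "k > 0"
    using assms by (simp add: k_def)
  have L': "L b'" "L e"
    unfolding b'_def e_def by (rule L; simp add: h_def power2_eq_square)+
  have v: "ip b' b' = of_real (B * k)" "ip e e = of_real (B * k)" "ip b' e = of_real B" "ip e b' = of_real B"
    unfolding b'_def e_def ipc of_real_eq_iff by (simp_all add: k_def h algebra_simps)
  have "L (b' + a')"
    using L_scale[OF L'(2), of "of_real k"] \<open>k > 0\<close> by (simp add: a'_def)
  moreover have "ip a' b' = 0"
    by (simp add: a'_def ip_simps v mult.commute)
  moreover have "ip a' a' = of_real (k * k * (B * k) - 2 * k * B + B * k)"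
    by (simp add: a'_def ip_simps cj_of_real v algebra_simps)
  moreover have "k * k * (B * k) - 2 * k * B + B * k = (x + x\<^sup>2 / 4) * (B * k)"
    by (simp add: k_def field_simps power2_eq_square)
  moreover have "B * k > 0"
    using * \<open>k > 0\<close> by simp
  ultimately show ?thesis
    unfolding L_tan2_def using L'(1) v(1) by metis
qed

text \<open>The members \<open>b + t a \<plusminus> s f\<close> are orthogonal if \<open>(2 t\<^sup>2 - t) x = -1\<close>, which is solvable for \<open>x \<ge> 8\<close> since
  \<open>2 t\<^sup>2 - t\<close> has minimum \<open>- 1 / 8\<close>.\<close>

lemma L_all_if_tan2_ge_8:
  assumes "L_tan2 x" "x \<ge> 8" "c \<in> X" "c \<noteq> 0"
  shows "L c"
proof -
  obtain b a B where *: "L b" "L (b + a)" "ip a b = 0" "B > 0"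
    "ip b b = of_real B" "ip a a = of_real (x * B)"
    using assms by (auto simp: L_tan2_def)
  obtain f where f: "f \<in> X" "ip f b = 0" "ip f a = 0" "ip f f = of_real (x * B)"
    using perp_of_square[of "x * B" b a] assms * by auto
  note 0 = *(3) f(2,3) *(3)[THEN ip_sym0[THEN iffD1]] f(2,3)[THEN ip_sym0[THEN iffD1]]
  \<comment> \<open>\<open>t = (1 + q) / 4\<close> is the larger root of
    \<open>2 t^2 - t = - 1 / x\<close>; it lies between 0 and 1, so \<open>s\<close> is
    real.\<close>
  define q where "q = sqrt (1 - 8 / x)"
  have q: "0 \<le> q" "q \<le> 1" "q\<^sup>2 = 1 - 8 / x"
    using assms by (auto simp: q_def)
  define t where "t = (1 + q) / 4"
  define s where "s = sqrt (t - t\<^sup>2)"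
  have t: "0 \<le> t" "t \<le> 1"
    using q by (auto simp: t_def)
  then have s: "s\<^sup>2 = t - t\<^sup>2"
    by (simp add: s_def power2_eq_square mult_left_le)
  have "(2 * t\<^sup>2 - t) = (q\<^sup>2 - 1) / 8"
    by (simp add: t_def power2_eq_square field_simps)
  then have "(2 * t\<^sup>2 - t) * x = -1"
    using q assms by simp
  then have z: "B + t\<^sup>2 * x * B - s\<^sup>2 * x * B = 0"
    unfolding s by (algebra)
  let ?c = "\<lambda>s. b + smul (of_real t) a + smul (of_real s) f"
  have "ip (?c s) (?c (-s)) = of_real (B + t\<^sup>2 * x * B - s\<^sup>2 * x * B)"
    using 0 * f by (simp add: ip_simps cj_of_real power2_eq_square)
  then have "ip (?c s) (?c (-s)) = 0"
    using z by simp
  moreover have "L (?c s)" "L (?c (-s))"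
    by (rule L_disc; use * f s in simp)+
  ultimately show ?thesis
    using L_all_if_orthogonal_pair assms by blast
qed

text \<open>Iterated steps never decrease the squared tangent, so each gains at least
  \<open>x^2 / 4\<close> and the value 8 is eventually passed.\<close>

lemma L_all_if_tan2_pos:
  assumes "L_tan2 x" "x > 0" "c \<in> X" "c \<noteq> 0"
  shows "L c"
proof -
  have "\<exists>y \<ge> x + real k * (x\<^sup>2 / 4). L_tan2 y" for k
  proof (induction k)
    case 0
    then show ?case using assms by auto
  next
    case (Suc k)
    then obtain y where y: "y \<ge> x + real k * (x\<^sup>2 / 4)" "L_tan2 y" by blast
    have "0 \<le> real k * (x\<^sup>2 / 4)"
      by simp
    then have "y \<ge> x"
      using y(1) by linarith
    then have "y + y\<^sup>2 / 4 \<ge> x + real (Suc k) * (x\<^sup>2 / 4)"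
    proof -
      have "x\<^sup>2 \<le> y\<^sup>2"
        using \<open>y \<ge> x\<close> assms(2) by (simp add: power_mono)
      moreover have "real (Suc k) * (x\<^sup>2 / 4) = real k * (x\<^sup>2 / 4) + x\<^sup>2 / 4"
        by (simp add: distrib_right)
      ultimately show ?thesis
        using y(1) by linarith
    qed
    moreover have "L_tan2 (y + y\<^sup>2 / 4)"
      by (rule L_tan2_step) (use y(2) \<open>y \<ge> x\<close> assms(2) in auto)
    ultimately show ?case by blast
  qed
  moreover have "0 < x\<^sup>2 / 4"
    using assms(2) by simp
  then obtain k where k: "8 < real k * (x\<^sup>2 / 4)"
    using reals_Archimedean3 by blast
  ultimately obtain y where "y \<ge> x + real k * (x\<^sup>2 / 4)" "L_tan2 y"
    by blast
  then show ?thesis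
    using k assms(2-4) L_all_if_tan2_ge_8[of y] by auto
qed

text \<open>If \<open>a\<close> and \<open>b\<close> are not orthogonal, rescaling \<open>a\<close>
  makes \<open>k a - b\<close> orthogonal to \<open>b\<close>; it is nonzero as the lines differ, so
  the squared tangent is positive.\<close>

lemma L_all:
  assumes "L a" "L b" "a \<notin> span {b}" "c \<in> X" "c \<noteq> 0"
  shows "L c"
proof (cases "ip a b = 0")
  case True
  then show ?thesis
    using L_all_if_orthogonal_pair assms by blast
next
  case False
  define k where "k = ip b b / ip a b"
  define a' where "a' = smul k a - b"
  have b: "b \<noteq> 0"
    using assms L_imp by blast
  then have k: "k \<noteq> 0"
    using False by (simp add: k_def)
  have a': "L (b + a')" "ip a' b = 0"
    using L_scale assms(1) k False by (simp_all add: a'_def k_def ip_simps)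
  have "a' \<noteq> 0"
  proof
    assume "a' = 0"
    then have "b = smul k a"
      by (simp add: a'_def)
    then have "a = smul (inverse k) b"
      using k by simp
    then show False
      using assms by (simp add: span_base span_scale)
  qed
  then obtain A where A: "A > 0" "ip a' a' = of_real A"
    using ip_pos by blast
  obtain B where B: "B > 0" "ip b b = of_real B"
    using ip_pos b by blast
  have "ip a' a' = of_real (A / B * B)"
    using A B by simp
  then have "L_tan2 (A / B)"
    unfolding L_tan2_def using a' assms(2) B by blast
  moreover have "A / B > 0"
    using A B by simp
  ultimately show ?thesis
    using L_all_if_tan2_pos assms by blast
qed

end

section \<open>Saturated sets when \<open>2 r \<le> d\<close>\<close>

locale saturated_family = conj_inner_product_space smul cj ip
  for smul :: "'k::real_normed_field \<Rightarrow> 'v::ab_group_add \<Rightarrow> 'v" and cj :: "'k \<Rightarrow> 'k"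
    and ip :: "'v \<Rightarrow> 'v \<Rightarrow> 'k" +
  fixes r d :: nat and S :: "'v set set"
  assumes r_pos: "1 \<le> r" and r_d: "2 * r \<le> d" and d_n: "d < dim (UNIV :: 'v set)"
    and sat: "tau_saturated smul ip r d S"
begin

lemma S_D: "Z \<in> S \<Longrightarrow> subspace Z" "Z \<in> S \<Longrightarrow> dim Z = r"
  using sat by (auto simp: tau_saturated_def grassmannian_def)

lemma S_I:
  assumes "Z \<in> S" "Z' \<in> S" "subspace P" "dim P = d" "Z \<subseteq> P" "subspace Y" "dim Y = r"
    "Y = orth_proj ip P ` Z'"
  shows "Y \<in> S"
proof -
  have "P \<in> grassmannian smul d" "Y \<in> grassmannian smul r"
    using assms by (auto simp: grassmannian_def)
  moreover from this(1) have "tau smul ip d Z Z' Y"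
    unfolding tau_def using assms by blast
  ultimately show ?thesis
    using sat assms(1,2) unfolding tau_saturated_def by blast
qed

text \<open>The space \<open>P\<close> below is chosen between \<open>span (insert c (H \<union> T))\<close> and the orthogonal complement of
  \<open>a - c\<close>, so that projecting to \<open>P\<close> fixes \<open>H\<close> and sends \<open>a\<close> to \<open>c\<close>.\<close>

lemma S_move:
  assumes T: "T \<in> S" and H: "subspace H" "Suc (dim H) = r" and a: "span (insert a H) \<in> S"
    and c: "c \<notin> H" and orth: "\<And>u. u \<in> H \<union> T \<Longrightarrow> ip (a - c) u = 0" "ip (a - c) c = 0"
  shows "span (insert c H) \<in> S"
proof (cases "a = c")
  case True
  then show ?thesis using a by simp
next
  case False
  let ?W = "{x. ip (a - c) x = 0}"
  let ?K = "span (insert c (H \<union> T))"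
  have "Suc (dim ?W) = dim (UNIV :: 'v set)"
    using dim_orth_complement_line[of UNIV "a - c"] False by (simp add: ip_sym0[of "a - c"])
  then have "d \<le> dim ?W"
    using d_n by simp
  \<comment> \<open>The count \<open>(r - 1) + r + 1 = 2 r\<close> is where
    \<open>2 r \<le> d\<close> enters.\<close>
  moreover have "dim (H \<union> T) \<le> dim H + dim T"
    using dim_span_Un_le[OF H(1) S_D(1)[OF T]] by simp
  then have "dim ?K \<le> d"
    using dim_span_insert_le[of c "H \<union> T"] S_D(2)[OF T] H r_d by linarith
  moreover have "?K \<subseteq> ?W"
    using orth by (intro span_minimal subspace_orth_right) auto
  ultimately obtain P where P: "subspace P" "?K \<subseteq> P" "P \<subseteq> ?W" "dim P = d"
    using intermediate_subspace[OF subspace_span subspace_orth_right, of "insert c (H \<union> T)" "a - c" d] by metis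
  have HT: "insert c (H \<union> T) \<subseteq> P"
    using P(2) span_superset[of "insert c (H \<union> T)"] by blast
  have proj: "orth_proj ip P (x + smul k a) = x + smul k c" if "x \<in> H" for x k
  proof (rule orth_proj_eqI[OF P(1)])
    show "x + smul k c \<in> P"
      using that HT P(1) by (intro subspace_add subspace_scale) auto
    fix u assume "u \<in> P"
    then have "ip (a - c) u = 0"
      using P(3) by blast
    then show "ip (x + smul k a - (x + smul k c)) u = 0"
      by (simp add: ip_simps algebra_simps)
  qed
  have spanH: "span (insert v H) = {x + smul k v | x k. x \<in> H}" for v
  proof -
    have "x \<in> span (insert v H) \<longleftrightarrow> (\<exists>k. x - smul k v \<in> H)" for x
      using H(1) by (simp add: span_insert span_eq_iff[THEN iffD2])
    moreover have "x - smul k v \<in> H \<longleftrightarrow> (\<exists>h. x = h + smul k v \<and> h \<in> H)" for x k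
      by (metis add_diff_cancel_right' diff_add_cancel)
    ultimately show ?thesis
      by blast
  qed
  have "span (insert c H) = orth_proj ip P ` span (insert a H)"
    unfolding spanH by (force simp: proj)
  moreover have "dim (span (insert c H)) = r"
    using dim_span_insert[OF H(1) c] H by simp
  ultimately show ?thesis
    using S_I[OF T a P(1,4)] HT by blast
qed

text \<open>Since \<open>Z \<inter> T\<close> lies in \<open>H\<close>, the direction
  \<open>a\<close> of \<open>Z\<close> over \<open>H\<close> is outside \<open>H + T\<close>. One
  move against \<open>T\<close> can therefore turn \<open>Z\<close> into a different member through
  \<open>H\<close>; from then on only members through \<open>H\<close> are used, and
  \<open>L_all\<close> applies.\<close>

lemma spine_hyperplane_subset:
  assumes Z: "Z \<in> S" and T: "T \<in> S" and H: "subspace H" "Suc (dim H) = r" "H \<subseteq> Z" "Z \<inter> T \<subseteq> H"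
    and Y: "subspace Y" "dim Y = r" "H \<subseteq> Y"
  shows "Y \<in> S"
proof -
  have HZ: "Suc (dim H) = dim Z" and HY: "Suc (dim H) = dim Y"
    using H(2) S_D(2)[OF Z] Y(2) by auto
  obtain a where a: "a \<noteq> 0" "\<And>u. u \<in> H \<Longrightarrow> ip a u = 0" "Z = span (insert a H)"
    using orthogonal_generator[OF H(1) S_D(1)[OF Z] H(3) HZ] by blast
  have aZ: "a \<in> Z" "a \<notin> H"
    using a(3) a(1) a(2)[of a] by (auto intro: span_base)
  have dHT: "dim (H \<union> T) < 2 * r"
    using dim_span_Un_le[OF H(1) S_D(1)[OF T]] S_D(2)[OF T] H(2) by simp
  let ?V = "span (H \<union> T)"
  have "a \<notin> ?V"
  proof
    assume "a \<in> ?V"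
    then obtain h t where ht: "h \<in> H" "t \<in> T" "a = h + t"
      by (auto simp: span_Un span_eq_iff[THEN iffD2] H(1) S_D(1)[OF T])
    then have "t = a - h" by simp
    moreover have "a - h \<in> Z"
      using ht(1) H(3) aZ(1) S_D(1)[OF Z] by (intro subspace_diff) auto
    ultimately have "t \<in> Z" by simp
    then have "a \<in> H"
      using ht H by (auto intro: subspace_add)
    then show False
      using aZ by blast
  qed
  define y where "y = orth_proj ip ?V a"
  define a1 where "a1 = a - y"
  have y: "y \<in> ?V" and a1V: "\<And>u. u \<in> ?V \<Longrightarrow> ip a1 u = 0"
    unfolding y_def a1_def using orth_proj_props[OF subspace_span[of "H \<union> T"]] by auto
  have a1: "a1 \<noteq> 0"
    using \<open>a \<notin> ?V\<close> y by (auto simp: a1_def)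
  \<comment> \<open>The component along \<open>e\<close> keeps the projection \<open>c\<close> of \<open>a\<close> to the complement of \<open>w = a1 + e\<close> out of \<open>Z\<close>.\<close>
  have "dim (insert a (H \<union> T)) < dim (UNIV :: 'v set)"
    using dim_span_insert_le[of a "H \<union> T"] dHT r_d d_n by simp
  then obtain e where e: "e \<noteq> 0" "\<And>u. u \<in> insert a (H \<union> T) \<Longrightarrow> ip e u = 0"
    using orthogonal_vector_exists by blast
  then have e_span: "ip e u = 0" if "u \<in> span (insert a (H \<union> T))" for u
    using that ip_span_right by blast
  have HT_sub: "?V \<subseteq> span (insert a (H \<union> T))"
    by (intro span_mono) auto
  then have "a1 \<in> span (insert a (H \<union> T))"
    unfolding a1_def using y by (intro span_diff) (auto intro: span_base)
  then have ea1: "ip e a1 = 0" "ip e a = 0"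
    using e_span e by auto
  define w where "w = a1 + e"
  have "ip a1 a = ip a1 a1"
    using a1V[OF y] by (simp add: a1_def ip_diff_right)
  then have wa: "ip w a = ip a1 a1"
    using ea1 by (simp add: w_def ip_simps)
  have "ip w a \<noteq> 0"
    using wa a1 by simp
  then have ww: "ip w w \<noteq> 0" and aw: "ip a w \<noteq> 0"
    using ip_sym0 by auto
  define s where "s = ip a w / ip w w"
  have s: "s \<noteq> 0"
    using ww aw by (simp add: s_def)
  define c where "c = a - smul s w"
  have wV: "ip w u = 0" if "u \<in> H \<union> T" for u
    using a1V[of u] e(2)[of u] that by (auto simp: w_def ip_simps intro: span_base)
  have cw: "ip c w = 0"
    using ww by (simp add: c_def s_def ip_simps)
  have ac: "a - c = smul s w"
    by (simp add: c_def)
  have cH: "ip c u = 0" if "u \<in> H" for u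
    using a(2)[OF that] wV[of u] that by (simp add: c_def ip_simps)
  have "ip c e = - s * ip e e"
    using ea1 ip_sym0[of e a] ip_sym0[of e a1] by (simp add: c_def w_def ip_simps)
  then have ce: "ip e c \<noteq> 0"
    using s e(1) by (simp add: ip_sym0[of e c])
  have "Z \<subseteq> span (insert a (H \<union> T))"
    unfolding a(3) by (intro span_mono) auto
  then have cZ: "c \<notin> Z"
    using ce e_span by blast
  have c: "span (insert c H) \<in> S"
  proof (rule S_move[OF T H(1,2)])
    show "span (insert a H) \<in> S"
      using Z a(3) by simp
    show "c \<notin> H"
      using cZ H by blast
    show "ip (a - c) u = 0" if "u \<in> H \<union> T" for u
      using wV[OF that] by (simp add: ac ip_simps)
    show "ip (a - c) c = 0"
      using cw by (simp add: ac ip_simps ip_sym0[of w])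
  qed
  let ?X = "{x. \<forall>u\<in>H. ip x u = 0}"
  let ?L = "\<lambda>x. x \<in> ?X \<and> x \<noteq> 0 \<and> span (insert x H) \<in> S"
  interpret line_family smul cj ip ?X ?L
  proof
    show "subspace ?X"
      by (auto simp: subspace_def ip_simps)
    show "x \<in> ?X \<and> x \<noteq> 0" if "?L x" for x
      using that by blast
    show "?L (smul k x)" if "?L x" "k \<noteq> 0" for x k
    proof -
      have "x \<in> span (insert (smul k x) H)"
        using span_scale[OF span_base, of "smul k x" "insert (smul k x) H" "inverse k"] that by simp
      then have "span (insert (smul k x) H) = span (insert x H)"
        by (intro span_eq[THEN iffD2])
          (auto intro: span_base span_scale)
      then show ?thesis
        using that by (simp add: ip_simps)
    qed
    show "?L y" if "?L x" "?L z" "y \<in> ?X" "y \<noteq> 0" "ip (x - y) z = 0" "ip (x - y) y = 0" for x z y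
    proof -
      have "y \<notin> H"
        using that by auto
      have "ip (x - y) u = 0" if "u \<in> insert z H" for u
        using that \<open>?L x\<close> \<open>y \<in> ?X\<close> \<open>ip (x - y) z = 0\<close> by (auto simp: ip_diff_left)
      then have "ip (x - y) u = 0" if "u \<in> span (insert z H)" for u
        using that ip_span_right by blast
      moreover have "H \<subseteq> span (insert z H)"
        using span_superset[of "insert z H"] by blast
      ultimately have orth: "ip (x - y) u = 0" if "u \<in> H \<union> span (insert z H)" for u
        using that by blast
      \<comment> \<open>The member spanned by \<open>z\<close> and \<open>H\<close> now plays the
        part of \<open>T\<close> in \<open>S_move\<close>.\<close>
      have "span (insert y H) \<in> S"
        by (rule S_move[of "span (insert z H)" H x y]) (use that H \<open>y \<notin> H\<close> orth in blast)+
      then show ?thesis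
        using that by blast
    qed
    show "\<exists>f\<in>?X. f \<noteq> 0 \<and> ip f x = 0 \<and> ip f z = 0" for x z
    proof -
      have "dim (insert x (insert z H)) \<le> Suc (Suc (dim H))"
        using dim_span_insert_le[of x "insert z H"] dim_span_insert_le[of z H] by simp
      then have "dim (insert x (insert z H)) < dim (UNIV :: 'v set)"
        using H(2) r_pos r_d d_n by linarith
      then obtain f where "f \<noteq> 0" "\<And>u. u \<in> insert x (insert z H) \<Longrightarrow> ip f u = 0"
        using orthogonal_vector_exists by blast
      then show ?thesis by blast
    qed
  qed
  obtain g where g: "g \<noteq> 0" "\<And>u. u \<in> H \<Longrightarrow> ip g u = 0" "Y = span (insert g H)"
    using orthogonal_generator[OF H(1) Y(1,3) HY] by blast
  have "c \<noteq> 0"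
    using cZ S_D(1)[OF Z] subspace_0 by blast
  then have "?L c" "?L a"
    using c cH a Z by auto
  moreover have "c \<notin> span {a}"
    using cZ aZ S_D(1)[OF Z] by (metis empty_subsetI insert_subset span_minimal subsetD)
  ultimately have "?L g"
    by (rule L_all[of c a g]) (use g in auto)
  then show ?thesis
    using g by blast
qed

text \<open>An exchange argument with \<open>U = Z \<inter> T\<close> kept fixed: a hyperplane of
  \<open>Z\<close> containing \<open>Z \<inter> Y\<close> is completed by a vector of
  \<open>Y\<close> outside \<open>Z\<close>, which brings \<open>Z\<close> closer to
  \<open>Y\<close>. Afterwards \<open>T\<close> is adjusted so that the intersection is
  \<open>U\<close> again.\<close>

lemma spine_inter_subset:
  assumes "Z \<in> S" "T \<in> S" "subspace Y" "dim Y = r" "Z \<inter> T \<subseteq> Y"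
  shows "Y \<in> S"
proof -
  define U where "U = Z \<inter> T"
  have subU: "subspace U"
    unfolding U_def using assms S_D by (intro subspace_inter) auto
  have UY: "U \<subseteq> Y"
    using assms by (simp add: U_def)
  have "Y \<in> S" if "Z \<in> S" "T \<in> S" "Z \<inter> T = U" for Z T
    using that
  proof (induction "r - dim (Z \<inter> Y)" arbitrary: Z T rule: less_induct)
    case less
    note Z = S_D[OF less.prems(1)] and T = S_D[OF less.prems(2)] and UZT = less.prems(3)
    show ?case
    proof (cases "Z \<subseteq> Y")
      case True
      then have "Z = Y"
        using Z assms by (intro subspace_dim_equal) auto
      then show ?thesis
        using less by simp
    next
      case False
      then obtain q where q: "q \<in> Z" "q \<notin> Y" by blast
      have ZY: "subspace (Z \<inter> Y)"
        using Z assms by (intro subspace_inter) auto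
      have "q \<notin> Z \<inter> Y"
        using q by blast
      then obtain H where H: "subspace H" "Z \<inter> Y \<subseteq> H" "H \<subseteq> Z" "q \<notin> H" "Suc (dim H) = dim Z"
        by (rule hyperplane_avoiding[OF ZY Z(1) Int_lower1 q(1)])
      have UH: "U \<subseteq> H"
        using H UY UZT by blast
      have "\<not> Y \<subseteq> Z"
        using q Z assms subspace_dim_equal[of Y Z] by auto
      then obtain t where t: "t \<in> Y" "t \<notin> Z" by blast
      let ?Z = "span (insert t H)"
      have tH: "t \<notin> H"
        using t H by blast
      have dZ': "dim ?Z = r"
        using dim_span_insert[OF H(1) tH] H Z by simp
      have HZ': "H \<subseteq> ?Z"
        using span_superset[of "insert t H"] by blast
      have Z'S: "?Z \<in> S"
        by (rule spine_hyperplane_subset[of Z T H]) (use less.prems H UH Z dZ' HZ' UZT in auto)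
      have "span (insert t (Z \<inter> Y)) \<subseteq> ?Z \<inter> Y"
      proof -
        have "insert t (Z \<inter> Y) \<subseteq> ?Z \<inter> Y"
          using H(2) t HZ' by (auto intro: span_base)
        then show ?thesis
          using assms by (intro span_minimal subspace_inter) auto
      qed
      then have "dim (span (insert t (Z \<inter> Y))) \<le> dim (?Z \<inter> Y)"
        by (rule dim_subset)
      then have "dim (Z \<inter> Y) < dim (?Z \<inter> Y)"
        using dim_span_insert[OF ZY, of t] t by simp
      moreover have "dim (?Z \<inter> Y) \<le> r"
        using dim_subset[of "?Z \<inter> Y" Y] assms by simp
      ultimately have decr: "r - dim (?Z \<inter> Y) < r - dim (Z \<inter> Y)"
        by linarith
      \<comment> \<open>If the new \<open>?Z\<close> meets \<open>T\<close> in more than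
        \<open>U\<close>, a hyperplane \<open>H'\<close> of \<open>T\<close> omitting an excess
        vector \<open>p\<close> is completed by a vector outside \<open>?Z + H'\<close>.\<close>
      have "\<exists>T'\<in>S. ?Z \<inter> T' = U"
      proof (cases "?Z \<inter> T = U")
        case True
        then show ?thesis
          using less.prems by blast
      next
        case False
        have "U \<subseteq> ?Z \<inter> T"
          using UH HZ' UZT by blast
        then obtain p where p: "p \<in> ?Z" "p \<in> T" "p \<notin> U"
          using False by blast
        have "U \<subseteq> T"
          using UZT by blast
        then obtain H' where H': "subspace H'" "U \<subseteq> H'" "H' \<subseteq> T" "p \<notin> H'" "Suc (dim H') = dim T"
          by (rule hyperplane_avoiding[OF subU T(1) _ p(2,3)])
        \<comment> \<open>Subtracting a multiple of \<open>p\<close> from \<open>x\<close> cancels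
          the \<open>t\<close>-component, so the rest lies in \<open>H \<inter> T\<close>, hence in
          \<open>U\<close>; as \<open>p\<close> is outside \<open>H'\<close>, the multiple
          vanishes.\<close>
        have ZH': "?Z \<inter> H' \<subseteq> U"
        proof
          fix x assume x: "x \<in> ?Z \<inter> H'"
          have HT: "H \<inter> T \<subseteq> U"
            using H UZT by blast
          obtain k where k: "x - smul k t \<in> H"
            using x H(1) by (auto simp: span_breakdown_eq span_eq_iff[THEN iffD2])
          obtain m where m: "p - smul m t \<in> H"
            using p H(1) by (auto simp: span_breakdown_eq span_eq_iff[THEN iffD2])
          have "m \<noteq> 0"
            using m p HT by auto
          then have eq: "x - smul (k / m) p = (x - smul k t) - smul (k / m) (p - smul m t)"
            by (simp add: algebra_simps)
          have "x - smul (k / m) p \<in> H"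
            unfolding eq by (rule subspace_diff[OF H(1) k subspace_scale[OF H(1) m]])
          moreover have "x - smul (k / m) p \<in> T"
            using x p T H'(3) by (intro subspace_diff subspace_scale) auto
          ultimately have xU: "x - smul (k / m) p \<in> U"
            using HT by blast
          have "x - (x - smul (k / m) p) \<in> H'"
            by (rule subspace_diff[OF H'(1)]) (use x xU H'(2) in blast)+
          then have kp: "smul (k / m) p \<in> H'" by simp
          have "k / m = 0"
          proof (rule ccontr)
            assume "k / m \<noteq> 0"
            then have "smul (inverse (k / m)) (smul (k / m) p) = p"
              by (metis scale_scale left_inverse scale_one)
            then show False
              using subspace_scale[OF H'(1) kp, of "inverse (k / m)"] H'(4) by simp
          qed
          then show "x \<in> U"
            using xU by (metis scale_zero_left diff_zero)
        qed
        have "dim (?Z \<union> H') \<le> dim ?Z + dim H'"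
          using dim_span_Un_le[OF subspace_span H'(1), of "insert t H"] by simp
        then have "dim (?Z \<union> H') < dim (UNIV :: 'v set)"
          using dZ' H'(5) T r_d d_n by linarith
        then obtain v where v: "v \<notin> span (?Z \<union> H')"
          using notin_proper_span by blast
        let ?T = "span (insert v H')"
        have "v \<notin> H'"
          using v by (auto intro: span_base)
        then have "dim ?T = r"
          using dim_span_insert[OF H'(1)] H' T by simp
        moreover have H'T: "H' \<subseteq> ?T"
          using span_superset[of "insert v H'"] by blast
        ultimately have "?T \<in> S"
        \<comment> \<open>The roles of \<open>T\<close> and the old \<open>Z\<close> are exchanged
          here: their intersection \<open>U\<close> lies in \<open>H'\<close>.\<close>
        proof (intro spine_hyperplane_subset[OF less.prems(2,1) H'(1) _ H'(3) _ subspace_span])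
          show "Suc (dim H') = r" "T \<inter> Z \<subseteq> H'"
            using H'(2,5) T(2) UZT by auto
        qed
        moreover have "?Z \<inter> ?T \<subseteq> U"
        proof
          fix x assume x: "x \<in> ?Z \<inter> ?T"
          then obtain k where k: "x - smul k v \<in> H'"
            using H'(1) by (auto simp: span_breakdown_eq span_eq_iff[THEN iffD2])
          have "x - (x - smul k v) \<in> span (?Z \<union> H')"
            using x k by (intro span_diff[OF span_base span_base]) auto
          then have "smul k v \<in> span (?Z \<union> H')" by simp
          then have "k = 0"
            using v by (metis span_scale scale_scale scale_one left_inverse)
          then show "x \<in> U" using k x ZH' by auto
        qed
        moreover have "U \<subseteq> ?Z \<inter> ?T"
          using UH HZ' H'(2) H'T by blast
        ultimately show ?thesis by blast
      qed
      then obtain T' where "T' \<in> S" "?Z \<inter> T' = U" by blast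
      then show ?thesis
        using less.hyps[OF decr Z'S] by blast
    qed
  qed
  then show ?thesis
    using assms U_def by blast
qed

lemma saturated_eq_spine: "S = spine smul r (\<Inter>S)"
proof (cases "S = {}")
  case True
  \<comment> \<open>The intersection of the empty family is \<open>UNIV\<close>, which no
    \<open>r\<close>-plane contains because \<open>r < dim UNIV\<close>.\<close>
  then show ?thesis
    using r_pos r_d d_n by (auto simp: spine_def grassmannian_def top.extremum_unique)
next
  case False
  let ?m = "\<lambda>p. dim (fst p \<inter> snd p)"
  obtain p where "p \<in> S \<times> S" "\<And>q. q \<in> S \<times> S \<Longrightarrow> ?m p \<le> ?m q"
    using False ex_has_least_nat[of "\<lambda>p. p \<in> S \<times> S" _ ?m] by (metis all_not_in_conv mem_Sigma_iff)
  then obtain Z T where ZT: "Z \<in> S" "T \<in> S" "\<And>Z' T'. Z' \<in> S \<Longrightarrow> T' \<in> S \<Longrightarrow> dim (Z \<inter> T) \<le> dim (Z' \<inter> T')"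
    by (cases p) force
  have sub: "subspace (Z \<inter> T)"
    using ZT S_D by (intro subspace_inter) auto
  have "dim (Z \<inter> T) \<le> r"
    using S_D(2)[OF ZT(1)] dim_subset[of "Z \<inter> T" Z] by simp
  have ZTY: "Z \<inter> T \<subseteq> Y" if Y: "Y \<in> S" for Y
  proof (rule ccontr)
    assume "\<not> Z \<inter> T \<subseteq> Y"
    have "r + dim Y \<le> dim (UNIV :: 'v set)"
      using S_D[OF Y] r_d d_n by simp
    \<comment> \<open>\<open>Z'\<close> belongs to \<open>S\<close> because it contains
      \<open>Z \<inter> T\<close>, and its intersection with \<open>Y\<close> would be smaller than
      the minimal one.\<close>
    then obtain Z' where Z': "subspace Z'" "Z \<inter> T \<subseteq> Z'" "dim Z' = r" "Z' \<inter> Y = (Z \<inter> T) \<inter> Y"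
      using avoiding_subspace[OF sub S_D(1)[OF Y] \<open>dim (Z \<inter> T) \<le> r\<close>] by blast
    then have "Z' \<in> S"
      using spine_inter_subset ZT by blast
    then have "dim (Z \<inter> T) \<le> dim ((Z \<inter> T) \<inter> Y)"
      using ZT(3)[OF _ Y] Z'(4) by metis
    then have "(Z \<inter> T) \<inter> Y = Z \<inter> T"
      using sub S_D[OF Y] by (intro subspace_dim_equal subspace_inter[OF sub]) auto
    then show False
      using \<open>\<not> Z \<inter> T \<subseteq> Y\<close> by blast
  qed
  then have "\<Inter>S = Z \<inter> T"
    using ZT by blast
  moreover have "S = spine smul r (Z \<inter> T)"
    unfolding spine_def grassmannian_def using spine_inter_subset[OF ZT(1,2)] S_D ZTY by blast
  ultimately show ?thesis by simp
qed

end

section \<open>Spines and the converse\<close>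

context conj_inner_product_space
begin

text \<open>Points of \<open>U\<close> lie in \<open>Z\<close>, hence in \<open>P\<close>, so the
  projection fixes them and they remain in the image of \<open>Z'\<close>.\<close>

lemma spine_tau_saturated: "tau_saturated smul ip r d (spine smul r U)"
  unfolding tau_saturated_def
proof (intro conjI ballI impI)
  show "spine smul r U \<subseteq> grassmannian smul r"
    by (auto simp: spine_def)
  fix Z Z' Y
  assume Z: "Z \<in> spine smul r U" "Z' \<in> spine smul r U"
    and Y: "Y \<in> grassmannian smul r" "tau smul ip d Z Z' Y"
  then obtain P where P: "subspace P" "Z \<subseteq> P" "Y = orth_proj ip P ` Z'"
    by (auto simp: tau_def grassmannian_def)
  have "x \<in> Y" if "x \<in> U" for x
  proof -
    have "x \<in> Z'" "x \<in> P"
      using that Z P(2) by (auto simp: spine_def)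
    then show ?thesis
      using orth_proj_id[OF P(1), of x] by (force simp: P(3))
  qed
  then show "Y \<in> spine smul r U"
    using Y by (auto simp: spine_def)
qed

text \<open>A vector outside \<open>U\<close> is avoided by some hyperplane containing
  \<open>U\<close>, and an \<open>r\<close>-plane fits between the two.\<close>

lemma Inter_spine:
  assumes "subspace U" "dim U \<le> r" "r < dim (UNIV :: 'v set)"
  shows "\<Inter>(spine smul r U) = U"
proof
  show "U \<subseteq> \<Inter>(spine smul r U)"
    by (auto simp: spine_def)
  show "\<Inter>(spine smul r U) \<subseteq> U"
  proof (rule ccontr)
    assume "\<not> \<Inter>(spine smul r U) \<subseteq> U"
    then obtain x where x: "x \<in> \<Inter>(spine smul r U)" "x \<notin> U" by blast
    obtain H where H: "subspace H" "U \<subseteq> H" "H \<subseteq> UNIV" "x \<notin> H" "Suc (dim H) = dim (UNIV :: 'v set)"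
      by (rule hyperplane_avoiding[OF assms(1) subspace_UNIV subset_UNIV UNIV_I x(2)])
    then obtain Z where "subspace Z" "U \<subseteq> Z" "Z \<subseteq> H" "dim Z = r"
      using intermediate_subspace[OF assms(1) H(1,2) assms(2)] assms(3) by auto
    then have "Z \<in> spine smul r U" "x \<notin> Z"
      using H(4) by (auto simp: spine_def grassmannian_def)
    then show False
      using x by blast
  qed
qed

lemma spine_UNIV: "r < dim (UNIV :: 'v set) \<Longrightarrow> spine smul r UNIV = {}"
  by (auto simp: spine_def grassmannian_def top.extremum_unique)

lemma spine_zero: "spine smul r {0} = grassmannian smul r"
  by (auto simp: spine_def grassmannian_def subspace_0)

text \<open>Intersection is the inverse of \<open>spine\<close> on the enlarged domain. The
  bijection on \<open>grassmannian_le\<close> follows by deleting \<open>{0}\<close> and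
  \<open>UNIV\<close> together with their images.\<close>

lemma saturated_sets_are_spines:
  assumes "1 \<le> r" "2 * r \<le> d" "d < dim (UNIV :: 'v set)"
  shows "saturated_sets_are_spines smul ip r d"
proof -
  have rn: "r < dim (UNIV :: 'v set)"
    using assms by simp
  have eq: "S = spine smul r (\<Inter>S)" if "tau_saturated smul ip r d S" for S
  proof -
    interpret saturated_family smul cj ip r d S
      using assms that by unfold_locales
    show ?thesis by (rule saturated_eq_spine)
  qed
  let ?G = "grassmannian_le smul r"
  let ?D = "{{0}, UNIV} \<union> ?G"
  have GI: "U \<in> ?G \<longleftrightarrow> subspace U \<and> dim U \<in> {1..r}" for U
    by (auto simp: grassmannian_le_def grassmannian_def)
  have "\<Inter>(spine smul r U) = U" if "U \<in> ?D" for U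
  proof (cases "U = UNIV")
    case True
    then show ?thesis
      using spine_UNIV[OF rn] by simp
  next
    case False
    then have "subspace U" "dim U \<le> r"
      using that by (auto simp: GI subspace_single_0)
    then show ?thesis
      using Inter_spine rn by blast
  qed
  then have inj: "inj_on (spine smul r) ?D"
    by (metis inj_onI)
  have D: "\<Inter>S \<in> ?D" if "tau_saturated smul ip r d S" for S
  proof (cases "S = {}")
    case False
    have S: "subspace Z \<and> dim Z = r" if "Z \<in> S" for Z
      using that \<open>tau_saturated smul ip r d S\<close> by (auto simp: tau_saturated_def grassmannian_def)
    then have sub: "subspace (\<Inter>S)"
      by (intro subspace_Inter) auto
    obtain Z where "Z \<in> S" using False by blast
    then have "dim (\<Inter>S) \<le> r"
      using S dim_subset[of "\<Inter>S" Z] by blast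
    show ?thesis
    proof (cases "dim (\<Inter>S) = 0")
      case True
      then have "\<Inter>S \<subseteq> {0}"
        by (simp only: dim_eq_0)
      then have "\<Inter>S = {0}"
        using subspace_0[OF sub] by blast
      then show ?thesis by simp
    next
      case False
      then have "dim (\<Inter>S) \<in> {1..r}"
        unfolding atLeastAtMost_iff using \<open>dim (\<Inter>S) \<le> r\<close> by linarith
      then have "\<Inter>S \<in> ?G"
        using sub GI by blast
      then show ?thesis by blast
    qed
  qed auto
  have bij: "bij_betw (spine smul r) ?D {S. tau_saturated smul ip r d S}"
    unfolding bij_betw_def
  proof (intro conjI inj equalityI subsetI)
    fix S assume "S \<in> {S. tau_saturated smul ip r d S}"
    then show "S \<in> spine smul r ` ?D"
      using eq D by (metis image_eqI mem_Collect_eq)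
  qed (auto simp: spine_tau_saturated)
  have "{0} \<notin> ?G" "UNIV \<notin> ?G"
    using rn by (auto simp: GI)
  then have "?G = ?D - {{0}, UNIV}"
    by blast
  moreover have "bij_betw (spine smul r) (?D - {{0}, UNIV})
      ({S. tau_saturated smul ip r d S} - spine smul r ` {{0}, UNIV})"
    by (rule bij_betw_DiffI[OF bij]) (use inj in \<open>auto simp: bij_betw_def inj_on_def spine_tau_saturated\<close>)
  ultimately have "bij_betw (spine smul r) ?G ({S. tau_saturated smul ip r d S} - {{}, grassmannian smul r})"
    using spine_UNIV[OF rn] spine_zero[of r] by (simp add: insert_commute)
  then show ?thesis
    unfolding saturated_sets_are_spines_def using eq bij by blast
qed

section \<open>Two-element saturated sets\<close>

text \<open>With \<open>a\<close> in \<open>Z\<close> only and \<open>b\<close> in \<open>T\<close>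
  only, \<open>a + b\<close> lies in neither; adjoined to a hyperplane of \<open>Z\<close>
  containing \<open>Z \<inter> T\<close>, it spans a third member.\<close>

lemma spine_third_element:
  assumes "Z \<in> spine smul r U" "T \<in> spine smul r U" "Z \<noteq> T"
  obtains Y where "Y \<in> spine smul r U" "Y \<noteq> Z" "Y \<noteq> T"
proof -
  have Z: "subspace Z" "dim Z = r" and T: "subspace T" "dim T = r" and U: "U \<subseteq> Z \<inter> T"
    using assms by (auto simp: spine_def grassmannian_def)
  obtain a where a: "a \<in> Z" "a \<notin> T"
    using subspace_dim_equal[OF Z(1) T(1)] assms(3) Z T by auto
  obtain b where b: "b \<in> T" "b \<notin> Z"
    using subspace_dim_equal[OF T(1) Z(1)] assms(3) Z T by auto
  have sub: "subspace (Z \<inter> T)"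
    using Z T by (intro subspace_inter)
  have "a \<notin> Z \<inter> T"
    using a by blast
  then obtain H where H: "subspace H" "Z \<inter> T \<subseteq> H" "H \<subseteq> Z" "a \<notin> H" "Suc (dim H) = dim Z"
    by (rule hyperplane_avoiding[OF sub Z(1) Int_lower1 a(1)])
  have ab: "a + b \<notin> Z" "a + b \<notin> T"
    using a b subspace_diff[OF Z(1), of "a + b" a] subspace_diff[OF T(1), of "a + b" b] by auto
  let ?Y = "span (insert (a + b) H)"
  have "a + b \<in> ?Y" "H \<subseteq> ?Y"
    by (auto intro: span_base)
  moreover have "dim ?Y = r"
    using dim_span_insert[OF H(1), of "a + b"] ab H Z by auto
  ultimately have "?Y \<in> spine smul r U" "?Y \<noteq> Z" "?Y \<noteq> T"
    using ab H U unfolding spine_def grassmannian_def by auto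
  then show ?thesis
    using that by blast
qed

lemma no_two_element_if_spines:
  assumes "saturated_sets_are_spines smul ip r d"
  shows "no_two_element_saturated_set smul ip r d"
  unfolding no_two_element_saturated_set_def
proof
  assume "\<exists>S. tau_saturated smul ip r d S \<and> card S = 2"
  then obtain S where S: "tau_saturated smul ip r d S" "card S = 2" by blast
  then obtain Z T where ZT: "S = {Z, T}" "Z \<noteq> T"
    by (auto simp: card_2_iff)
  define U where "U = \<Inter>S"
  have S_eq: "S = spine smul r U"
    unfolding U_def using S assms by (auto simp: saturated_sets_are_spines_def)
  then have "Z \<in> spine smul r U" "T \<in> spine smul r U"
    using ZT by auto
  then obtain Y where "Y \<in> spine smul r U" "Y \<noteq> Z" "Y \<noteq> T"
    using ZT(2) by (rule spine_third_element)
  then show False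
    using S_eq ZT(1) by auto
qed

text \<open>Projecting \<open>W + B\<close> to \<open>P\<close> fixes \<open>W\<close> and sends \<open>B\<close> into the orthogonal complement of \<open>Z\<close> in \<open>P\<close>, whose
  dimension \<open>d - r\<close> is smaller than that of \<open>B\<close>.\<close>

lemma not_tau_if_orthogonal:
  assumes Z: "subspace Z" "dim Z = r" and W: "W \<subseteq> Z" and WB: "\<And>b u. b \<in> B \<Longrightarrow> u \<in> Z \<Longrightarrow> ip b u = 0"
    and d: "dim W + d < 2 * r" and T: "T \<subseteq> {w + b | w b. w \<in> W \<and> b \<in> B}" and W_sub: "subspace W"
    and Y: "dim Y = r"
  shows "\<not> tau smul ip d Z T Y"
proof
  assume "tau smul ip d Z T Y"
  then obtain P where P: "subspace P" "dim P = d" "Z \<subseteq> P" "Y = orth_proj ip P ` T"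
    by (auto simp: tau_def grassmannian_def)
  let ?Q = "{x \<in> P. \<forall>u\<in>Z. ip x u = 0}"
  have Q: "subspace ?Q"
    using P(1) by (auto simp: subspace_def ip_simps)
  have "Z \<inter> ?Q \<subseteq> {0}"
    by auto
  then have "dim (Z \<inter> ?Q) = 0"
    by simp
  moreover have "{x + y |x y. x \<in> Z \<and> y \<in> ?Q} \<subseteq> P"
    using P by (auto intro: subspace_add)
  then have "dim {x + y |x y. x \<in> Z \<and> y \<in> ?Q} \<le> d"
    unfolding P(2)[symmetric] by (rule dim_subset)
  ultimately have dQ: "r + dim ?Q \<le> d"
    using dim_sums_Int[OF Z(1) Q] Z(2) by linarith
  have "Y \<subseteq> span (W \<union> ?Q)"
  proof
    fix y assume "y \<in> Y"
    then obtain w b where wb: "w \<in> W" "b \<in> B" "y = orth_proj ip P (w + b)"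
      using P(4) T by blast
    let ?p = "orth_proj ip P b"
    note p = orth_proj_props[OF P(1), where x = b]
    have "y = w + ?p"
      unfolding wb(3) using wb(1) W P p by (intro orth_proj_eqI) (auto intro: subspace_add)
    moreover have "ip ?p u = 0" if "u \<in> Z" for u
      using p(2)[of u] WB[OF wb(2) that] P(3) that by (auto simp: ip_simps)
    then have "?p \<in> ?Q"
      using p(1) by blast
    ultimately show "y \<in> span (W \<union> ?Q)"
      using wb(1) by (auto intro!: span_add intro: span_base)
  qed
  then have "dim Y \<le> dim W + dim ?Q"
    using dim_subset[of Y "span (W \<union> ?Q)"] dim_span_Un_le[OF W_sub Q] by linarith
  then show False
    using Y dQ d by linarith
qed

lemma two_element_saturated_set:
  assumes "r < d" "d < 2 * r" "d < dim (UNIV :: 'v set)"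
  shows "\<not> no_two_element_saturated_set smul ip r d"
proof -
  \<comment> \<open>One more than the dimension left around an \<open>r\<close>-plane in a
    \<open>d\<close>-dimensional space. Here \<open>d < 2 r\<close> gives \<open>k \<le> r\<close>,
    and \<open>r + k = d + 1\<close> leaves room for \<open>B\<close> orthogonal to
    \<open>Z\<close>.\<close>
  define k where "k = d - r + 1"
  have k: "k \<le> r" "r + k \<le> dim (UNIV :: 'v set)" "0 < k" "d < r + k"
    using assms by (auto simp: k_def)
  have zero_sub: "subspace {0}"
    by (rule subspace_single_0)
  obtain Z where Z: "subspace Z" "{0} \<subseteq> Z" "Z \<subseteq> UNIV" "dim Z = r"
    by (rule intermediate_subspace[OF zero_sub subspace_UNIV subset_UNIV, of r]) (use k in auto)
  obtain W where W: "subspace W" "{0} \<subseteq> W" "W \<subseteq> Z" "dim W = r - k"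
    by (rule intermediate_subspace[OF zero_sub Z(1,2), of "r - k"]) (use Z in auto)
  define perp where "perp U = {x. \<forall>u\<in>U. ip x u = 0}" for U
  have perp_sub: "subspace (perp U)" for U
    by (auto simp: subspace_def perp_def ip_simps)
  have "dim (UNIV :: 'v set) \<le> dim Z + dim (perp Z)"
  proof -
    have "x \<in> span (Z \<union> perp Z)" for x
    proof -
      have "orth_proj ip Z x \<in> Z" "x - orth_proj ip Z x \<in> perp Z"
        using orth_proj_props[OF Z(1)] by (auto simp: perp_def)
      then have "orth_proj ip Z x + (x - orth_proj ip Z x) \<in> span (Z \<union> perp Z)"
        by (intro span_add) (auto intro: span_base)
      then show ?thesis by simp
    qed
    then have "span (Z \<union> perp Z) = UNIV" by blast
    then show ?thesis
      using dim_span_Un_le[OF Z(1) perp_sub, of Z] by simp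
  qed
  then have "k \<le> dim (perp Z)"
    using k Z by linarith
  then obtain B where B: "subspace B" "{0} \<subseteq> B" "B \<subseteq> perp Z" "dim B = k"
    by (rule_tac intermediate_subspace[OF zero_sub perp_sub, of Z k])
       (use subspace_0[OF perp_sub] in auto)
  \<comment> \<open>\<open>A\<close> makes the situation symmetric: \<open>Z = W + A\<close> with
    \<open>A\<close> orthogonal to \<open>T\<close>, just as \<open>T = W + B\<close> with
    \<open>B\<close> orthogonal to \<open>Z\<close>.\<close>
  define A where "A = Z \<inter> perp W"
  define T where "T = {w + b | w b. w \<in> W \<and> b \<in> B}"
  have T_sub: "subspace T"
    unfolding T_def using subspace_sums[OF W(1) B(1)] .
  have "Z \<inter> B \<subseteq> {0}"
    using B(3) by (force simp: perp_def)
  then have ZB: "Z \<inter> B = {0}"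
    using Z B by blast
  then have "dim (W \<inter> B) = 0"
    using W(3) by auto
  then have dT: "dim T = r"
    using dim_sums_Int[OF W(1) B(1)] W(4) B(4) k unfolding T_def by linarith
  have WT: "W \<subseteq> T"
    unfolding T_def using subspace_0[OF B(1)] by force
  have BT: "B \<subseteq> T"
    unfolding T_def using subspace_0[OF W(1)] by force
  have ZA: "Z \<subseteq> {w + a | w a. w \<in> W \<and> a \<in> A}"
  proof
    fix z assume z: "z \<in> Z"
    let ?w = "orth_proj ip W z"
    have w: "?w \<in> W" "z - ?w \<in> perp W"
      using orth_proj_props[OF W(1)] by (auto simp: perp_def)
    then have "z - ?w \<in> A"
      unfolding A_def using z W(3) Z(1) by (auto intro: subspace_diff)
    moreover have "z = ?w + (z - ?w)" by simp
    ultimately show "z \<in> {w + a | w a. w \<in> W \<and> a \<in> A}"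
      using w(1) by blast
  qed
  have AT: "ip a t = 0" if a: "a \<in> A" and t: "t \<in> T" for a t
  proof -
    obtain w b where "w \<in> W" "b \<in> B" "t = w + b"
      using t unfolding T_def by blast
    then show ?thesis
      using a B(3) ip_sym0[of a b] by (auto simp: A_def perp_def ip_simps)
  qed
  have dk: "dim W + d < 2 * r"
    using W(4) k by linarith
  have "\<not> tau smul ip d Z T Y" "\<not> tau smul ip d T Z Y" if "dim Y = r" for Y
  proof -
    show "\<not> tau smul ip d Z T Y"
      by (rule not_tau_if_orthogonal[OF Z(1,4) W(3) _ dk _ W(1) that, of B])
         (use B(3) in \<open>auto simp: perp_def T_def\<close>)
    show "\<not> tau smul ip d T Z Y"
      by (rule not_tau_if_orthogonal[OF T_sub dT WT AT dk ZA W(1) that])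
  qed
  \<comment> \<open>A plane paired with itself is fixed by the projection, so only the two mixed
    pairs could leave \<open>{Z, T}\<close>, and these were just excluded.\<close>
  moreover have "Y = U" if "tau smul ip d U U Y" for U Y
    using that by (force simp: tau_def grassmannian_def orth_proj_id subset_iff image_def)
  ultimately have "tau_saturated smul ip r d {Z, T}"
    using Z T_sub dT by (auto simp: tau_saturated_def grassmannian_def)
  moreover have "Z \<noteq> T"
  proof
    assume "Z = T"
    then have "B = {0}"
      using BT ZB by blast
    then show False
      using B(4) k by simp
  qed
  then have "card {Z, T} = 2" by simp
  ultimately show ?thesis
    unfolding no_two_element_saturated_set_def by blast
qed

end

section \<open>Transfer to real and complex scalars\<close>

lemma real_hilbert_space_conj:
  assumes "real_hilbert_space n smul ip"
  shows "conj_inner_product_space smul (\<lambda>c. c) ip"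
proof -
  interpret fd_inner_product_space smul "\<lambda>c. c" ip
    using assms by (simp add: real_hilbert_space_def)
  show ?thesis by unfold_locales simp_all
qed

lemma complex_hilbert_space_conj:
  assumes "complex_hilbert_space n smul ip"
  shows "conj_inner_product_space smul cnj ip"
proof -
  interpret fd_inner_product_space smul cnj ip
    using assms by (simp add: complex_hilbert_space_def)
  show ?thesis by unfold_locales simp_all
qed

(* HOL cannot quantify over types inside a formula: 'a and 'b are arbitrary types, and (smul, ip)
   ranges over all n-dimensional real (complex) Hilbert space structures on 'a (on 'b).  The
   assumptions real_ex and complex_ex only say that this range is not empty. *)

theorem theorem1p8:
  fixes r d n :: nat
  assumes "1 \<le> r" and "r < d" and "d < n" and "n \<ge> 3"
    and real_ex: "\<exists>(smul :: real \<Rightarrow> 'a::ab_group_add \<Rightarrow> 'a) ip. real_hilbert_space n smul ip"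
    and complex_ex: "\<exists>(smul :: complex \<Rightarrow> 'b::ab_group_add \<Rightarrow> 'b) ip. complex_hilbert_space n smul ip"
  shows
    "(2 * r \<le> d \<longleftrightarrow>
        (\<forall>(smul :: real \<Rightarrow> 'a \<Rightarrow> 'a) ip.
           real_hilbert_space n smul ip \<longrightarrow> saturated_sets_are_spines smul ip r d) \<and>
        (\<forall>(smul :: complex \<Rightarrow> 'b \<Rightarrow> 'b) ip.
           complex_hilbert_space n smul ip \<longrightarrow> saturated_sets_are_spines smul ip r d)) \<and>
     (2 * r \<le> d \<longleftrightarrow>
        (\<forall>(smul :: real \<Rightarrow> 'a \<Rightarrow> 'a) ip.
           real_hilbert_space n smul ip \<longrightarrow> no_two_element_saturated_set smul ip r d) \<and>
        (\<forall>(smul :: complex \<Rightarrow> 'b \<Rightarrow> 'b) ip.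
           complex_hilbert_space n smul ip \<longrightarrow> no_two_element_saturated_set smul ip r d))"
proof -
  have real: "(2 * r \<le> d \<longrightarrow> saturated_sets_are_spines smul ip r d) \<and>
      (saturated_sets_are_spines smul ip r d \<longrightarrow> no_two_element_saturated_set smul ip r d) \<and>
      (no_two_element_saturated_set smul ip r d \<longrightarrow> 2 * r \<le> d)"
    if "real_hilbert_space n smul ip" for smul :: "real \<Rightarrow> 'a \<Rightarrow> 'a" and ip
  proof -
    interpret conj_inner_product_space smul "\<lambda>c. c" ip
      using that by (rule real_hilbert_space_conj)
    have "dim UNIV = n"
      using that by (simp add: real_hilbert_space_def)
    then show ?thesis
      using saturated_sets_are_spines[of r d] no_two_element_if_spines[of r d]
        two_element_saturated_set[of r d] assms(1-3) by force
  qed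
  have complex: "(2 * r \<le> d \<longrightarrow> saturated_sets_are_spines smul ip r d) \<and>
      (saturated_sets_are_spines smul ip r d \<longrightarrow> no_two_element_saturated_set smul ip r d)"
    if "complex_hilbert_space n smul ip" for smul :: "complex \<Rightarrow> 'b \<Rightarrow> 'b" and ip
  proof -
    interpret conj_inner_product_space smul cnj ip
      using that by (rule complex_hilbert_space_conj)
    have "dim UNIV = n"
      using that by (simp add: complex_hilbert_space_def)
    then show ?thesis
      using saturated_sets_are_spines[of r d] no_two_element_if_spines[of r d] assms(1-3) by force
  qed
  show ?thesis
    \<comment> \<open>Both converses pass through the absence of two-element saturated sets, applied
      to the real structure supplied by \<open>real_ex\<close>.\<close>
    using real complex real_ex by metis
qed

end
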